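(* Let $\bm Z=(Z_1,\dots,Z_n)$ be stationary with marginal distribution function $\Psi$. Let $\bm\psi$ be either the deterministic proxy $\psi_k=\Psi^{-1}(k/(n+1))$, $1\le k\le n$, or the random proxy $\bm\psi=\bm\xi^{\uparrow}$, where $\bm\xi=(\xi_1,\dots,\xi_n)$ is an auxiliary i.i.d. sample with distribution function $\Psi$. Let $\omega:\mathbb{R}\to[0,\infty)$ be bounded and continuous, $\bm w=\omega(\bm\psi)$ and $W=\|\omega\|_\infty$. Assume that some non-negative numbers $\{\rho_{ij}:1\le i,j\le n\}$ satisfy $$\big|\mathrm{Cov}\big[\mathbf 1_{\{Z_i\le x\}},\mathbf 1_{\{Z_j\le x\}}\big]\big|\le\rho_{ij}\,\Psi(x)(1-\Psi(x)),\qquad x\in\mathbb{R},$$ and set $D_n=\sum_{i=1}^n\sum_{j=1}^n\rho_{ij}$. Then $$\mathbb{E}\big[\langle\bm w,|\bm Z^{\uparrow}-\bm\psi|\rangle\big]\le W\big(\sqrt{D_n}+\sqrt n\big)\int_{-\infty}^{\infty}\sqrt{\Psi(x)(1-\Psi(x))}\,dx,$$ $$\mathbb{E}\big[\langle\bm w,|\bm Z^{\uparrow}-\bm\psi|^2\rangle\big]\le 4W\big(\sqrt{D_n}+\sqrt n\big)\int_{-\infty}^{\infty}|x|\sqrt{\Psi(x)(1-\Psi(x))}\,dx.$$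
   Context: $\Psi^{-1}(u)=\inf\{x\in\mathbb{R}:\Psi(x)\ge u\}$ for $u\in(0,1)$. $\bm x^{\uparrow}$ is the non-decreasing rearrangement of $\bm x\in\mathbb{R}^n$; functions of vectors are applied coordinatewise; $\langle\cdot,\cdot\rangle$ is the Euclidean inner product. *)

theory Defs
  imports "HOL-Probability.Probability"
begin

text \<open>A vector in $n$-dimensional Euclidean space is a function \<open>x :: nat \<Rightarrow> real\<close>, of which only the
  values at the indices \<open>1, \<dots>, n\<close> matter; a random vector is a function
  \<open>X :: nat \<Rightarrow> 'a \<Rightarrow> real\<close>, with \<open>X i\<close> its \<open>i\<close>-th coordinate.\<close>

text \<open>The generalised inverse. The real infimum is meaningful for a distribution function \<open>\<Psi>\<close> and
  \<open>0 < u < 1\<close>, when the set is nonempty and bounded below.\<close>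

definition quantile :: "(real \<Rightarrow> real) \<Rightarrow> real \<Rightarrow> real" where
  "quantile \<Psi> u = Inf {x. \<Psi> x \<ge> u}"

text \<open>Lists are indexed from 0, hence the shift in the index.\<close>

definition increasing_rearrangement :: "nat \<Rightarrow> (nat \<Rightarrow> real) \<Rightarrow> nat \<Rightarrow> real" where
  "increasing_rearrangement n x k = sort (map x [1..<Suc n]) ! (k - 1)"

definition inner_upto :: "nat \<Rightarrow> (nat \<Rightarrow> real) \<Rightarrow> (nat \<Rightarrow> real) \<Rightarrow> real" where
  "inner_upto n x y = (\<Sum>k=1..n. x k * y k)"

definition covariance :: "'a measure \<Rightarrow> ('a \<Rightarrow> real) \<Rightarrow> ('a \<Rightarrow> real) \<Rightarrow> real" where
  "covariance M X Y =
     integral\<^sup>L M (\<lambda>s. (X s - integral\<^sup>L M X) * (Y s - integral\<^sup>L M Y))"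

text \<open>Strict stationarity of a finite random vector: for all \<open>m\<close> and \<open>h\<close> with \<open>m + h \<le> n\<close>, the blocks
  \<open>(Z 1, \<dots>, Z m)\<close> and \<open>(Z (1 + h), \<dots>, Z (m + h))\<close> have the same joint law.\<close>

definition stationary_vector :: "'a measure \<Rightarrow> nat \<Rightarrow> (nat \<Rightarrow> 'a \<Rightarrow> real) \<Rightarrow> bool" where
  "stationary_vector M n Z \<longleftrightarrow>
     (\<forall>i\<in>{1..n}. Z i \<in> borel_measurable M) \<and>
     (\<forall>m h. m + h \<le> n \<longrightarrow>
        distr M (\<Pi>\<^sub>M i\<in>{1..m}. borel) (\<lambda>s. \<lambda>i\<in>{1..m}. Z (i + h) s) =
        distr M (\<Pi>\<^sub>M i\<in>{1..m}. borel) (\<lambda>s. \<lambda>i\<in>{1..m}. Z i s))"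

definition has_marginal_cdf ::
    "'a measure \<Rightarrow> nat \<Rightarrow> (nat \<Rightarrow> 'a \<Rightarrow> real) \<Rightarrow> (real \<Rightarrow> real) \<Rightarrow> bool" where
  "has_marginal_cdf M n Z \<Psi> \<longleftrightarrow> (\<forall>i\<in>{1..n}. cdf (distr M borel (Z i)) = \<Psi>)"

definition iid_sample ::
    "'a measure \<Rightarrow> nat \<Rightarrow> (nat \<Rightarrow> 'a \<Rightarrow> real) \<Rightarrow> (real \<Rightarrow> real) \<Rightarrow> bool" where
  "iid_sample M n \<xi> \<Psi> \<longleftrightarrow>
     prob_space.indep_vars M (\<lambda>_. borel) \<xi> {1..n} \<and> has_marginal_cdf M n \<xi> \<Psi>"

definition deterministic_proxy ::
    "'a measure \<Rightarrow> nat \<Rightarrow> (real \<Rightarrow> real) \<Rightarrow> (nat \<Rightarrow> 'a \<Rightarrow> real) \<Rightarrow> bool" where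
  "deterministic_proxy M n \<Psi> \<psi> \<longleftrightarrow>
     (\<forall>s\<in>space M. \<forall>k\<in>{1..n}. \<psi> k s = quantile \<Psi> (real k / (real n + 1)))"

text \<open>The auxiliary sample lives on the same probability space as the data; nothing is assumed about
  its joint law with the data, so that an independent sample is a special case.\<close>

definition random_proxy ::
    "'a measure \<Rightarrow> nat \<Rightarrow> (real \<Rightarrow> real) \<Rightarrow> (nat \<Rightarrow> 'a \<Rightarrow> real) \<Rightarrow> bool" where
  "random_proxy M n \<Psi> \<psi> \<longleftrightarrow>
     (\<exists>\<xi>. iid_sample M n \<xi> \<Psi> \<and>
        (\<forall>s\<in>space M. \<forall>k\<in>{1..n}. \<psi> k s = increasing_rearrangement n (\<lambda>i. \<xi> i s) k))"

end

theory Submission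
  imports Defs
begin

text \<open>The layer-cake formula gives \<open>\<bar>a - b\<bar> = \<integral> \<bar>1{a \<le> x} - 1{b \<le> x}\<bar> dx\<close> and
  \<open>\<bar>a - b\<bar>\<^sup>2 \<le> 4 \<integral> \<bar>x\<bar> \<bar>1{a \<le> x} - 1{b \<le> x}\<bar> dx\<close>. For two sorted vectors the
  differences of indicators at a fixed level \<open>x\<close> all have the same sign, so their absolute values sum
  to the difference of the counting functions. By Fubini it remains to compare, at each level \<open>x\<close>,
  each of the two counting functions with \<open>n \<Psi>(x)\<close> in mean: for the data and for the random proxy
  this is the standard deviation bound, and for the deterministic proxy it is an elementary
  inequality for \<open>\<lfloor>(n + 1) \<Psi>(x)\<rfloor>\<close>.\<close>

section \<open>Counting functions and sorted vectors\<close>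

text \<open>As a function of \<open>t\<close> this is \<open>n\<close> times the empirical
  distribution function of the vector.\<close>

definition count_below :: "nat \<Rightarrow> (nat \<Rightarrow> real) \<Rightarrow> real \<Rightarrow> real" where
  "count_below n x t = (\<Sum>i=1..n. indicator {..t} (x i))"

text \<open>The level \<open>g s\<close> may vary with \<open>s\<close>: on a product space it can
  be the second coordinate, which yields the joint measurability in sample point and level that
  Fubini needs.\<close>

lemma measurable_count_below [measurable]:
  assumes [measurable]: "\<And>i. i \<in> {1..n} \<Longrightarrow> X i \<in> borel_measurable M"
    and [measurable]: "g \<in> borel_measurable M"
  shows "(\<lambda>s. count_below n (\<lambda>i. X i s) (g s)) \<in> borel_measurable M"
proof -
  have "(\<lambda>s. indicator {..g s} (X i s) :: real) \<in> borel_measurable M" if "i \<in> {1..n}" for i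
  proof -
    have [measurable]: "X i \<in> borel_measurable M"
      using that by (rule assms)
    have "(\<lambda>s. if X i s \<le> g s then 1 else (0::real)) \<in> borel_measurable M"
      by measurable
    then show ?thesis
      by (simp add: indicator_def)
  qed
  then show ?thesis
    unfolding count_below_def by (rule borel_measurable_sum)
qed

lemma increasing_rearrangement_mono:
  assumes "1 \<le> j" "j \<le> k" "k \<le> n"
  shows "increasing_rearrangement n x j \<le> increasing_rearrangement n x k"
  unfolding increasing_rearrangement_def
  by (rule sorted_nth_mono) (use assms in auto)

text \<open>Sorting preserves the multiset of entries, and a sum in a commutative monoid depends on
  nothing else. The case used below is that of an indicator \<open>f\<close>.\<close>

lemma sum_increasing_rearrangement:
  fixes f :: "real \<Rightarrow> 'b::comm_monoid_add"
  shows "(\<Sum>k=1..n. f (increasing_rearrangement n x k)) = (\<Sum>i=1..n. f (x i))"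
proof -
  let ?xs = "map x [1..<Suc n]"
  have "(\<Sum>k=1..n. f (increasing_rearrangement n x k)) = (\<Sum>k<n. f (sort ?xs ! k))"
    unfolding increasing_rearrangement_def
    by (rule sum.reindex_bij_witness[of _ Suc "\<lambda>k. k - 1"]) auto
  also have "\<dots> = sum_list (map f (sort ?xs))"
    by (simp add: sum_list_sum_nth lessThan_atLeast0)
  also have "\<dots> = sum_list (map f ?xs)"
    by (metis mset_map mset_sort sum_mset_sum_list)
  also have "\<dots> = (\<Sum>i=1..n. f (x i))"
    by (simp add: sum_list_distinct_conv_sum_set atLeastLessThanSuc_atLeastAtMost o_def
        del: upt_Suc)
  finally show ?thesis .
qed

lemma count_below_increasing_rearrangement:
  "count_below n (increasing_rearrangement n x) t = count_below n x t"
  unfolding count_below_def by (rule sum_increasing_rearrangement)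

text \<open>The indices at which a sorted vector is at most \<open>t\<close> form an initial segment
  of \<open>{1..n}\<close>. Two initial segments are nested, so one indicator dominates the other at
  every index and the absolute value can be taken outside the sum.\<close>

lemma sum_abs_indicator_diff_mono:
  assumes u: "\<And>j k. 1 \<le> j \<Longrightarrow> j \<le> k \<Longrightarrow> k \<le> n \<Longrightarrow> u j \<le> u k"
    and v: "\<And>j k. 1 \<le> j \<Longrightarrow> j \<le> k \<Longrightarrow> k \<le> n \<Longrightarrow> v j \<le> v k"
  shows "(\<Sum>k=1..n. \<bar>indicator {..t} (u k) - indicator {..t} (v k)\<bar>)
    = \<bar>count_below n u t - count_below n v t\<bar>"
proof -
  have "(\<forall>k\<in>{1..n}. v k \<le> t \<longrightarrow> u k \<le> t) \<or> (\<forall>k\<in>{1..n}. u k \<le> t \<longrightarrow> v k \<le> t)"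
  proof (rule ccontr)
    assume "\<not> ?thesis"
    then obtain j k where "j \<in> {1..n}" "k \<in> {1..n}" "v j \<le> t" "\<not> u j \<le> t" "u k \<le> t" "\<not> v k \<le> t"
      by blast
    \<comment> \<open>If \<open>j \<le> k\<close>, then \<open>u j \<le> u k \<le> t\<close>;
      otherwise \<open>v k \<le> v j \<le> t\<close>. Either contradicts the choice of
      \<open>j\<close> and \<open>k\<close>.\<close>
    then show False
      using u[of j k] u[of k j] v[of j k] v[of k j] by (cases "j \<le> k") auto
  qed
  then consider "\<And>k. k \<in> {1..n} \<Longrightarrow> indicator {..t} (v k) \<le> (indicator {..t} (u k) :: real)"
    | "\<And>k. k \<in> {1..n} \<Longrightarrow> indicator {..t} (u k) \<le> (indicator {..t} (v k) :: real)"
    by (auto simp: indicator_def)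
  then show ?thesis
  proof cases
    case 1
    then have "(\<Sum>k=1..n. \<bar>indicator {..t} (u k) - indicator {..t} (v k)\<bar>)
      = count_below n u t - count_below n v t"
      unfolding count_below_def sum_subtractf[symmetric] by (intro sum.cong) auto
    moreover have "0 \<le> count_below n u t - count_below n v t"
      unfolding count_below_def sum_subtractf[symmetric] using 1 by (intro sum_nonneg) auto
    ultimately show ?thesis
      by simp
  next
    case 2
    then have "(\<Sum>k=1..n. \<bar>indicator {..t} (u k) - indicator {..t} (v k)\<bar>)
      = count_below n v t - count_below n u t"
      unfolding count_below_def sum_subtractf[symmetric] by (intro sum.cong) auto
    moreover have "0 \<le> count_below n v t - count_below n u t"
      unfolding count_below_def sum_subtractf[symmetric] using 2 by (intro sum_nonneg) auto
    ultimately show ?thesis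
      by simp
  qed
qed

section \<open>Layer-cake formulas for the first and second power\<close>

text \<open>The two indicators differ exactly when \<open>x\<close> lies in the half-open interval
  from the smaller to the larger number, and the integral is its length.\<close>

lemma abs_diff_eq_nn_integral_indicator:
  "ennreal \<bar>a - b\<bar> = (\<integral>\<^sup>+ x. ennreal \<bar>indicator {..x} a - indicator {..x} b\<bar> \<partial>lborel)"
proof -
  have "(\<integral>\<^sup>+ x. ennreal \<bar>indicator {..x} a - indicator {..x} b\<bar> \<partial>lborel)
    = (\<integral>\<^sup>+ x. indicator {min a b..<max a b} x \<partial>lborel)"
    by (intro nn_integral_cong) (auto simp: indicator_def)
  also have "\<dots> = ennreal (max a b - min a b)"
    by (simp)
  also have "max a b - min a b = \<bar>a - b\<bar>"
    by (simp add: max_def min_def)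
  finally show ?thesis ..
qed

text \<open>The primitive \<open>x * \<bar>x\<bar> / 2\<close> works on both sides of the origin, so
  intervals containing 0 need no splitting.\<close>

lemma nn_integral_abs_Icc:
  fixes a b :: real
  assumes "a \<le> b"
  shows "(\<integral>\<^sup>+ x. ennreal \<bar>x\<bar> * indicator {a..b} x \<partial>lborel) = ennreal (b * \<bar>b\<bar> / 2 - a * \<bar>a\<bar> / 2)"
proof (rule nn_integral_FTC_Icc[where F = "\<lambda>x. x * \<bar>x\<bar> / 2"])
  fix x :: real
  show "((\<lambda>x. x * \<bar>x\<bar> / 2) has_real_derivative \<bar>x\<bar>) (at x)"
  \<comment> \<open>At the kink of the absolute value the difference quotient
    \<open>\<bar>h\<bar> / 2\<close> is computed directly; elsewhere the primitive agrees locally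
    with plus or minus half the square.\<close>
  proof (cases "x = 0")
    case True
    have "((\<lambda>h::real. h * \<bar>h\<bar> / 2 / h) \<longlongrightarrow> 0) (at 0)"
    proof (rule Lim_transform_eventually)
      show "((\<lambda>h::real. \<bar>h\<bar> / 2) \<longlongrightarrow> 0) (at 0)"
        by (auto intro!: tendsto_eq_intros)
      show "\<forall>\<^sub>F h::real in at 0. \<bar>h\<bar> / 2 = h * \<bar>h\<bar> / 2 / h"
        by (auto simp: eventually_at_filter)
    qed
    then show ?thesis
      using True by (simp add: DERIV_def)
  next
    case False
    then consider "0 < x" | "x < 0"
      by linarith
    then show ?thesis
    proof cases
      case 1
      have "((\<lambda>x. x * x / 2) has_real_derivative \<bar>x\<bar>) (at x)"
        using 1 by (auto intro!: derivative_eq_intros)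
      then show ?thesis
        by (rule has_field_derivative_transform_within_open[of _ _ _ "{0<..}"]) (use 1 in auto)
    next
      case 2
      have "((\<lambda>x. - (x * x) / 2) has_real_derivative \<bar>x\<bar>) (at x)"
        using 2 by (auto intro!: derivative_eq_intros)
      then show ?thesis
        by (rule has_field_derivative_transform_within_open[of _ _ _ "{..<0}"]) (use 2 in auto)
    qed
  qed
qed (use assms in auto)

text \<open>With \<open>l\<close> the smaller and \<open>u\<close> the larger number, the integral
  equals \<open>2 * (u * \<bar>u\<bar> - l * \<bar>l\<bar>)\<close>. The factor 4 is forced by
  intervals symmetric about 0: for \<open>l = - u\<close> the integral of
  \<open>\<bar>x\<bar>\<close> is the square of \<open>u\<close>, while the squared length is four
  times as large.\<close>

lemma power2_diff_le_nn_integral_indicator: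
  "ennreal (\<bar>a - b\<bar>\<^sup>2)
    \<le> (\<integral>\<^sup>+ x. ennreal (4 * \<bar>x\<bar> * \<bar>indicator {..x} a - indicator {..x} b\<bar>) \<partial>lborel)"
proof -
  define l u where "l = min a b" and "u = max a b"
  have lu: "l \<le> u" "\<bar>a - b\<bar>\<^sup>2 = (u - l)\<^sup>2"
    unfolding l_def u_def by (auto simp: min_def max_def power2_commute)
  have "(u - l)\<^sup>2 \<le> 4 * (u * \<bar>u\<bar> / 2 - l * \<bar>l\<bar> / 2)"
  proof -
    \<comment> \<open>Right side minus left side is \<open>(u - l) * (u + 3 * l)\<close>,
      \<open>(u - l) * (- l - 3 * u)\<close> and the square of \<open>u + l\<close> in the three
      cases.\<close>
    consider "0 \<le> l" | "u \<le> 0" | "l < 0" "0 < u"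
      by linarith
    then show ?thesis
    proof cases
      case 1
      then have "0 \<le> (u - l) * (u + 3 * l)"
        using lu by (intro mult_nonneg_nonneg) auto
      then show ?thesis
        using 1 lu by (simp add: power2_eq_square algebra_simps)
    next
      case 2
      then have "0 \<le> (u - l) * (- l - 3 * u)"
        using lu by (intro mult_nonneg_nonneg) auto
      then show ?thesis
        using 2 lu by (simp add: power2_eq_square algebra_simps)
    next
      case 3
      have "0 \<le> (u + l)\<^sup>2"
        by simp
      then show ?thesis
        using 3 lu by (simp add: power2_eq_square algebra_simps)
    qed
  qed
  then have "ennreal (\<bar>a - b\<bar>\<^sup>2) \<le> ennreal 4 * ennreal (u * \<bar>u\<bar> / 2 - l * \<bar>l\<bar> / 2)"
    unfolding lu(2) by (subst ennreal_mult'[symmetric]) (auto intro: ennreal_leI)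
  also have "\<dots> = (\<integral>\<^sup>+ x. ennreal 4 * (ennreal \<bar>x\<bar> * indicator {l..u} x) \<partial>lborel)"
    by (simp add: nn_integral_abs_Icc[OF lu(1)] nn_integral_cmult)
  also have "\<dots> = (\<integral>\<^sup>+ x. ennreal (4 * \<bar>x\<bar> * \<bar>indicator {..x} a - indicator {..x} b\<bar>) \<partial>lborel)"
  proof (rule nn_integral_cong_AE)
    show "AE x in lborel. ennreal 4 * (ennreal \<bar>x\<bar> * indicator {l..u} x)
        = ennreal (4 * \<bar>x\<bar> * \<bar>indicator {..x} a - indicator {..x} b\<bar>)"
      \<comment> \<open>The closed interval and the half-open one on which the indicators differ
        disagree only at the endpoint \<open>u\<close>, a null set.\<close>
      using AE_lborel_singleton[of u]
      by eventually_elim (auto simp: l_def u_def indicator_def ennreal_mult' min_def max_def)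
  qed
  finally show ?thesis .
qed

section \<open>Mean deviation of counting functions of random vectors\<close>

text \<open>This is the Jensen inequality, read off from the nonnegativity of the variance of
  \<open>\<bar>S\<bar>\<close>; boundedness supplies the integrability.\<close>

lemma (in prob_space) nn_integral_abs_le_sqrt_expectation_power2:
  fixes S :: "'a \<Rightarrow> real"
  assumes [measurable]: "S \<in> borel_measurable M" and bnd: "\<And>s. \<bar>S s\<bar> \<le> C"
  shows "(\<integral>\<^sup>+ s. ennreal \<bar>S s\<bar> \<partial>M) \<le> ennreal (sqrt (expectation (\<lambda>s. (S s)\<^sup>2)))"
proof -
  have int: "integrable M (\<lambda>s. \<bar>S s\<bar>)"
    by (rule integrable_const_bound[of _ C]) (use bnd in auto)
  have "\<bar>S s\<bar>\<^sup>2 \<le> C\<^sup>2" for s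
    using bnd[of s] by (intro power_mono) auto
  then have "integrable M (\<lambda>s. \<bar>S s\<bar>\<^sup>2)"
    by (intro integrable_const_bound[of _ "C\<^sup>2"]) auto
  then have "variance (\<lambda>s. \<bar>S s\<bar>) = expectation (\<lambda>s. \<bar>S s\<bar>\<^sup>2) - (expectation (\<lambda>s. \<bar>S s\<bar>))\<^sup>2"
    using int by (rule variance_eq[rotated])
  moreover have "0 \<le> variance (\<lambda>s. \<bar>S s\<bar>)"
    by (rule variance_positive)
  ultimately have "expectation (\<lambda>s. \<bar>S s\<bar>) \<le> sqrt (expectation (\<lambda>s. (S s)\<^sup>2))"
    by (intro real_le_rsqrt) simp
  then show ?thesis
    using int by (simp add: nn_integral_eq_integral ennreal_leI)
qed

lemma (in prob_space) expectation_indicator_atMost: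
  assumes [measurable]: "X \<in> borel_measurable M"
  shows "expectation (\<lambda>s. indicator {..x} (X s)) = cdf (distr M borel X) x"
proof -
  have "expectation (\<lambda>s. indicator {..x} (X s)) = expectation (indicator (X -` {..x} \<inter> space M))"
    by (intro Bochner_Integration.integral_cong) (auto simp: indicator_def)
  also have "\<dots> = cdf (distr M borel X) x"
    by (simp add: cdf_def measure_distr)
  finally show ?thesis .
qed

text \<open>The centred count is a sum of centred indicators, so its second moment is the double sum
  of their covariances. Stating the covariance bound with a general \<open>\<rho>\<close> lets the
  lemma serve the data and the auxiliary sample alike.\<close>

lemma (in prob_space) nn_integral_count_below_deviation_le:
  assumes X: "\<And>i. i \<in> {1..n} \<Longrightarrow> X i \<in> borel_measurable M"
    and cdf: "has_marginal_cdf M n X \<Psi>"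
    and cov: "\<And>i j. i \<in> {1..n} \<Longrightarrow> j \<in> {1..n} \<Longrightarrow>
      covariance M (\<lambda>s. indicator {..x} (X i s)) (\<lambda>s. indicator {..x} (X j s))
        \<le> \<rho> i j * (\<Psi> x * (1 - \<Psi> x))"
  shows "(\<integral>\<^sup>+ s. ennreal \<bar>count_below n (\<lambda>i. X i s) x - real n * \<Psi> x\<bar> \<partial>M)
    \<le> ennreal (sqrt (\<Sum>i=1..n. \<Sum>j=1..n. \<rho> i j) * sqrt (\<Psi> x * (1 - \<Psi> x)))"
proof -
  define Y where "Y i s = indicator {..x} (X i s) - \<Psi> x" for i s
  define S where "S s = count_below n (\<lambda>i. X i s) x - real n * \<Psi> x" for s
  have Y: "Y i \<in> borel_measurable M" if "i \<in> {1..n}" for i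
    unfolding Y_def using X[OF that] by measurable
  have Y_bnd: "\<bar>Y i s\<bar> \<le> 1 + \<bar>\<Psi> x\<bar>" for i s
    by (auto simp: Y_def indicator_def)
  have S_eq: "S s = (\<Sum>i=1..n. Y i s)" for s
    by (simp add: S_def Y_def count_below_def sum_subtractf)
  have mean: "expectation (\<lambda>s. indicator {..x} (X i s)) = \<Psi> x" if "i \<in> {1..n}" for i
    using that cdf X[OF that] by (simp add: expectation_indicator_atMost has_marginal_cdf_def)
  have int: "integrable M (\<lambda>s. Y i s * Y j s)" if "i \<in> {1..n}" "j \<in> {1..n}" for i j
  proof (rule integrable_const_bound[of _ "(1 + \<bar>\<Psi> x\<bar>) * (1 + \<bar>\<Psi> x\<bar>)"])
    show "AE s in M. norm (Y i s * Y j s) \<le> (1 + \<bar>\<Psi> x\<bar>) * (1 + \<bar>\<Psi> x\<bar>)"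
      using Y_bnd by (auto simp: abs_mult intro!: mult_mono)
    show "(\<lambda>s. Y i s * Y j s) \<in> borel_measurable M"
      using Y that by auto
  qed
  have "expectation (\<lambda>s. (S s)\<^sup>2) = expectation (\<lambda>s. \<Sum>i=1..n. \<Sum>j=1..n. Y i s * Y j s)"
    by (simp add: S_eq power2_eq_square sum_product)
  also have "\<dots> = (\<Sum>i=1..n. \<Sum>j=1..n. expectation (\<lambda>s. Y i s * Y j s))"
    using int
    by (subst Bochner_Integration.integral_sum)
      (auto intro!: sum.cong Bochner_Integration.integral_sum Bochner_Integration.integrable_sum)
  \<comment> \<open>Each indicator has mean \<open>\<Psi> x\<close>, so the expected product of
    \<open>Y i\<close> and \<open>Y j\<close> is exactly the covariance bounded in the
    hypothesis.\<close>
  also have "\<dots> \<le> (\<Sum>i=1..n. \<Sum>j=1..n. \<rho> i j * (\<Psi> x * (1 - \<Psi> x)))"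
    using cov by (intro sum_mono) (simp add: covariance_def mean Y_def)
  also have "\<dots> = (\<Sum>i=1..n. \<Sum>j=1..n. \<rho> i j) * (\<Psi> x * (1 - \<Psi> x))"
    by (simp add: sum_distrib_right)
  finally have var: "expectation (\<lambda>s. (S s)\<^sup>2) \<le> (\<Sum>i=1..n. \<Sum>j=1..n. \<rho> i j) * (\<Psi> x * (1 - \<Psi> x))" .
  have "(\<integral>\<^sup>+ s. ennreal \<bar>S s\<bar> \<partial>M) \<le> ennreal (sqrt (expectation (\<lambda>s. (S s)\<^sup>2)))"
  proof (rule nn_integral_abs_le_sqrt_expectation_power2)
    show "S \<in> borel_measurable M"
      unfolding S_eq[abs_def] using Y by (rule borel_measurable_sum)
    show "\<bar>S s\<bar> \<le> (\<Sum>i=1..n. 1 + \<bar>\<Psi> x\<bar>)" for s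
      unfolding S_eq using Y_bnd by (intro order_trans[OF sum_abs] sum_mono) auto
  qed
  also have "\<dots> \<le> ennreal (sqrt (\<Sum>i=1..n. \<Sum>j=1..n. \<rho> i j) * sqrt (\<Psi> x * (1 - \<Psi> x)))"
    using var by (intro ennreal_leI) (simp flip: real_sqrt_mult)
  finally show ?thesis
    unfolding S_def .
qed

text \<open>For an independent sample the Kronecker delta can be taken as \<open>\<rho>\<close>, and
  its double sum is \<open>n\<close>.\<close>

lemma (in prob_space) nn_integral_count_below_iid_deviation_le:
  assumes "iid_sample M n \<xi> \<Psi>"
  shows "(\<integral>\<^sup>+ s. ennreal \<bar>count_below n (\<lambda>i. \<xi> i s) x - real n * \<Psi> x\<bar> \<partial>M)
    \<le> ennreal (sqrt (real n) * sqrt (\<Psi> x * (1 - \<Psi> x)))"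
proof -
  have indep: "indep_vars (\<lambda>_. borel) \<xi> {1..n}" and cdf: "has_marginal_cdf M n \<xi> \<Psi>"
    using assms by (auto simp: iid_sample_def)
  have meas: "\<xi> i \<in> borel_measurable M" if "i \<in> {1..n}" for i
    using indep that by (auto simp: indep_vars_def)
  define I where "I i s = (indicator {..x} (\<xi> i s) :: real)" for i s
  have mean: "expectation (I i) = \<Psi> x" if "i \<in> {1..n}" for i
    unfolding I_def using that cdf meas[OF that]
    by (simp add: expectation_indicator_atMost has_marginal_cdf_def)
  have int: "integrable M (I i)" if "i \<in> {1..n}" for i
    unfolding I_def using meas[OF that]
    by (intro integrable_const_bound[of _ 1]) (auto simp: indicator_def)
  have int_prod: "integrable M (\<lambda>s. I i s * I j s)" if "i \<in> {1..n}" "j \<in> {1..n}" for i j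
    unfolding I_def using meas[OF that(1)] meas[OF that(2)]
    by (intro integrable_const_bound[of _ 1]) (auto simp: indicator_def)
  have prod: "expectation (\<lambda>s. I i s * I j s) = (if i = j then \<Psi> x else \<Psi> x * \<Psi> x)"
    if ij: "i \<in> {1..n}" "j \<in> {1..n}" for i j
  proof (cases "i = j")
    case True
    have "expectation (\<lambda>s. I i s * I j s) = expectation (I i)"
      using True by (intro Bochner_Integration.integral_cong) (auto simp: I_def indicator_def)
    then show ?thesis
      using True mean ij by simp
  next
    case False
    have "indep_vars (\<lambda>_. borel) I {1..n}"
      unfolding I_def by (rule indep_vars_compose2[OF indep]) measurable
    then have "indep_vars (\<lambda>_. borel) I {i, j}"
      by (rule indep_vars_subset) (use ij in auto)
    then have "expectation (\<lambda>s. \<Prod>k\<in>{i, j}. I k s) = (\<Prod>k\<in>{i, j}. expectation (I k))"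
      using int ij by (intro indep_vars_lebesgue_integral) auto
    then show ?thesis
      using False mean ij by simp
  qed
  \<comment> \<open>On the diagonal an indicator is its own square, which gives the Bernoulli
    variance; off the diagonal independence makes the covariance vanish.\<close>
  have "covariance M (I i) (I j) \<le> (if i = j then 1 else 0) * (\<Psi> x * (1 - \<Psi> x))"
    if ij: "i \<in> {1..n}" "j \<in> {1..n}" for i j
  proof -
    have "covariance M (I i) (I j)
      = expectation (\<lambda>s. I i s * I j s - \<Psi> x * I i s - \<Psi> x * I j s + \<Psi> x * \<Psi> x)"
      unfolding covariance_def using mean ij
      by (intro Bochner_Integration.integral_cong) (auto simp: algebra_simps)
    also have "\<dots> = expectation (\<lambda>s. I i s * I j s) - \<Psi> x * \<Psi> x"
      using int int_prod mean ij by (simp add: prob_space)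
    finally show ?thesis
      using prod[OF ij] by (auto simp: algebra_simps)
  qed
  then have "(\<integral>\<^sup>+ s. ennreal \<bar>count_below n (\<lambda>i. \<xi> i s) x - real n * \<Psi> x\<bar> \<partial>M)
    \<le> ennreal (sqrt (\<Sum>i=1..n. \<Sum>j=1..n. if i = j then 1 else 0) * sqrt (\<Psi> x * (1 - \<Psi> x)))"
    by (intro nn_integral_count_below_deviation_le meas cdf) (auto simp: I_def[abs_def])
  also have "(\<Sum>i=1..n. \<Sum>j=1..n. if i = j then 1 else 0) = real n"
    by simp
  finally show ?thesis .
qed

section \<open>Quantiles and the deterministic proxy\<close>

text \<open>The limits of the distribution function at both infinities make the set under the
  infimum nonempty and bounded below, and right continuity puts the infimum into the set.\<close>

lemma (in real_distribution) quantile_le_iff: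
  assumes "0 < u" "u < 1"
  shows "quantile (cdf M) u \<le> x \<longleftrightarrow> u \<le> cdf M x"
proof -
  let ?S = "{x. u \<le> cdf M x}"
  have "\<forall>\<^sub>F y in at_top. u < cdf M y"
    using cdf_lim_at_top_prob assms(2) by (rule order_tendstoD)
  then obtain y where "u < cdf M y"
    by (auto simp: eventually_at_top_linorder)
  then have ne: "?S \<noteq> {}"
    by (auto intro: less_imp_le)
  have "\<forall>\<^sub>F y in at_bot. cdf M y < u"
    using cdf_lim_at_bot assms(1) by (rule order_tendstoD)
  then obtain z where z: "cdf M z < u"
    by (auto simp: eventually_at_bot_linorder)
  have bdd: "bdd_below ?S"
  proof (rule bdd_belowI)
    fix y assume "y \<in> ?S"
    then show "z \<le> y"
      using z cdf_nondecreasing[of y z] by (cases "z \<le> y") auto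
  qed
  show ?thesis
  proof
    assume "u \<le> cdf M x"
    then show "quantile (cdf M) u \<le> x"
      unfolding quantile_def using bdd by (intro cInf_lower) auto
  next
    assume le: "quantile (cdf M) u \<le> x"
    \<comment> \<open>A point strictly above the infimum lies above a member of the set, so
      monotonicity applies there; the limit from the right then reaches \<open>x\<close>
      itself.\<close>
    have "u \<le> cdf M y" if "x < y" for y
    proof -
      have "Inf ?S < y"
        using le that by (simp add: quantile_def)
      then obtain z where "z \<in> ?S" "z < y"
        using ne bdd by (auto simp: cInf_less_iff)
      then show ?thesis
        using cdf_nondecreasing[of z y] by auto
    qed
    then have "\<forall>\<^sub>F y in at_right x. u \<le> cdf M y"
      by (auto simp: eventually_at_filter)
    moreover have "(cdf M \<longlongrightarrow> cdf M x) (at_right x)"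
      using cdf_is_right_cont[of x] by (simp add: continuous_within)
    ultimately show "u \<le> cdf M x"
      by (intro tendsto_lowerbound) auto
  qed
qed

text \<open>The count is \<open>m\<close>, the integer part of \<open>(n + 1) * p\<close>. On either
  side of \<open>n * p\<close> the deviation has two upper bounds, one from rounding and one from
  \<open>0 \<le> m \<le> n\<close>, and their product is \<open>n * p * (1 - p)\<close>.\<close>

lemma abs_card_grid_diff_le:
  fixes p :: real
  assumes "0 \<le> p" "p \<le> 1"
  shows "\<bar>real (card {k \<in> {1..n}. real k / (real n + 1) \<le> p}) - real n * p\<bar>
    \<le> sqrt (real n) * sqrt (p * (1 - p))"
proof (cases "p = 1")
  \<comment> \<open>At \<open>p = 1\<close> the integer part would be \<open>n + 1\<close>, one more
    than the number of grid points; here the count is \<open>n\<close> and both sides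
    vanish.\<close>
  case True
  then have "{k \<in> {1..n}. real k / (real n + 1) \<le> p} = {1..n}"
    by (auto simp: divide_simps)
  then show ?thesis
    using True by simp
next
  case False
  define m where "m = nat \<lfloor>(real n + 1) * p\<rfloor>"
  have m: "real m \<le> (real n + 1) * p" "(real n + 1) * p < real m + 1"
    using assms unfolding m_def by (auto simp: of_nat_nat)
  have "(real n + 1) * p < real n + 1"
    using False assms by (simp add: mult_less_cancel_left)
  then have "real m < real n + 1"
    using m(1) by linarith
  then have "m \<le> n"
    by linarith
  have grid: "real k / (real n + 1) \<le> p \<longleftrightarrow> k \<le> m" for k
  proof -
    have "real k / (real n + 1) \<le> p \<longleftrightarrow> real k \<le> (real n + 1) * p"
      by (simp add: divide_le_eq mult.commute)
    also have "\<dots> \<longleftrightarrow> k \<le> m"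
      using m by linarith
    finally show ?thesis .
  qed
  have "{k \<in> {1..n}. real k / (real n + 1) \<le> p} = {1..m}"
    unfolding grid using \<open>m \<le> n\<close> by auto
  moreover have "\<bar>real m - real n * p\<bar> \<le> sqrt (real n * (p * (1 - p)))"
  proof (rule real_le_rsqrt)
    consider "m \<le> real n * p" | "real n * p < m"
      by linarith
    then show "\<bar>real m - real n * p\<bar>\<^sup>2 \<le> real n * (p * (1 - p))"
    proof cases
      case 1
      \<comment> \<open>Rounding loses less than 1, hence the bound \<open>1 - p\<close>; the bound
        \<open>n * p\<close> comes from \<open>0 \<le> m\<close>.\<close>
      have a: "real n * p - real m \<le> 1 - p"
        using m by (simp add: algebra_simps)
      have b: "real n * p - real m \<le> real n * p"
        by simp
      have "(real n * p - real m) * (real n * p - real m) \<le> (1 - p) * (real n * p)"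
        using 1 a b assms by (intro mult_mono) auto
      then show ?thesis
        unfolding power2_abs unfolding power2_eq_square by argo
    next
      case 2
      \<comment> \<open>Rounding down gives the bound \<open>p\<close>, and \<open>m \<le> n\<close>
        gives \<open>n * (1 - p)\<close>.\<close>
      have a: "real m - real n * p \<le> p"
        using m by (simp add: algebra_simps)
      have b: "real m - real n * p \<le> real n * (1 - p)"
        using \<open>m \<le> n\<close> by (simp add: algebra_simps)
      have "(real m - real n * p) * (real m - real n * p) \<le> p * (real n * (1 - p))"
        using 2 a b assms by (intro mult_mono) auto
      then show ?thesis
        unfolding power2_abs unfolding power2_eq_square by argo
    qed
  qed
  ultimately show ?thesis
    by (simp add: real_sqrt_mult)
qed

text \<open>By \<open>quantile_le_iff\<close>, counting quantiles up to \<open>x\<close> amounts to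
  counting grid points up to \<open>cdf M x\<close>.\<close>

lemma (in real_distribution) count_below_quantile_deviation_le:
  "\<bar>count_below n (\<lambda>k. quantile (cdf M) (real k / (real n + 1))) x - real n * cdf M x\<bar>
    \<le> sqrt (real n) * sqrt (cdf M x * (1 - cdf M x))"
proof -
  have "count_below n (\<lambda>k. quantile (cdf M) (real k / (real n + 1))) x
    = (\<Sum>k=1..n. if real k / (real n + 1) \<le> cdf M x then 1 else 0)"
    unfolding count_below_def
    by (intro sum.cong) (auto simp: indicator_def quantile_le_iff)
  also have "\<dots> = real (card {k \<in> {1..n}. real k / (real n + 1) \<le> cdf M x})"
    by (simp add: sum.If_cases Int_def)
  finally show ?thesis
    using abs_card_grid_diff_le[OF cdf_nonneg cdf_bounded_prob] by simp
qed

lemma (in real_distribution) quantile_mono: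
  assumes "0 < u" "u \<le> v" "v < 1"
  shows "quantile (cdf M) u \<le> quantile (cdf M) v"
proof -
  have "v \<le> cdf M (quantile (cdf M) v)"
    using assms quantile_le_iff[of v "quantile (cdf M) v"] by simp
  then show ?thesis
    using assms quantile_le_iff[of u] by simp
qed

section \<open>From deviations at each level to the weighted distance\<close>

text \<open>A common form of both bounds and both proxies: \<open>\<phi>\<close> is the power of the
  distance, \<open>h\<close> its layer-cake density, and \<open>\<eta>\<close> a measurable vector
  with the same counting function as the sorted \<open>\<psi>\<close>.\<close>

lemma (in prob_space) nn_integral_inner_upto_rearrangement_le:
  fixes \<phi> h r :: "real \<Rightarrow> real"
  assumes Z: "\<And>i. i \<in> {1..n} \<Longrightarrow> Z i \<in> borel_measurable M"
    and \<eta>: "\<And>i. i \<in> {1..n} \<Longrightarrow> \<eta> i \<in> borel_measurable M"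
    and \<psi>_mono: "\<And>s j k. s \<in> space M \<Longrightarrow> 1 \<le> j \<Longrightarrow> j \<le> k \<Longrightarrow> k \<le> n \<Longrightarrow> \<psi> j s \<le> \<psi> k s"
    and \<psi>_count: "\<And>s x. s \<in> space M \<Longrightarrow>
      count_below n (\<lambda>k. \<psi> k s) x = count_below n (\<lambda>i. \<eta> i s) x"
    and Z_dev: "\<And>x. (\<integral>\<^sup>+ s. ennreal \<bar>count_below n (\<lambda>i. Z i s) x - c x\<bar> \<partial>M)
      \<le> ennreal (A * r x)"
    and \<eta>_dev: "\<And>x. (\<integral>\<^sup>+ s. ennreal \<bar>count_below n (\<lambda>i. \<eta> i s) x - c x\<bar> \<partial>M)
      \<le> ennreal (B * r x)"
    and \<omega>: "\<And>x. 0 \<le> \<omega> x" "\<And>x. \<omega> x \<le> W"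
    and h: "h \<in> borel_measurable borel" "\<And>x. 0 \<le> h x"
    and nonneg: "0 \<le> A" "0 \<le> B" "\<And>x. 0 \<le> r x" "\<And>y. 0 \<le> \<phi> y" and r: "r \<in> borel_measurable borel"
    and \<phi>: "\<And>a b. ennreal (\<phi> \<bar>a - b\<bar>)
      \<le> (\<integral>\<^sup>+ x. ennreal (h x * \<bar>indicator {..x} a - indicator {..x} b\<bar>) \<partial>lborel)"
  shows "(\<integral>\<^sup>+ s. ennreal (inner_upto n (\<lambda>k. \<omega> (\<psi> k s))
            (\<lambda>k. \<phi> \<bar>increasing_rearrangement n (\<lambda>i. Z i s) k - \<psi> k s\<bar>)) \<partial>M)
    \<le> ennreal (W * (A + B)) * (\<integral>\<^sup>+ x. ennreal (h x * r x) \<partial>lborel)"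
proof -
  interpret pair_sigma_finite M lborel ..
  note [measurable] = h(1) r
  define G where "G s x = \<bar>count_below n (\<lambda>i. Z i s) x - count_below n (\<lambda>i. \<eta> i s) x\<bar>" for s x
  have W: "0 \<le> W"
    using \<omega>[of 0] by linarith
  have count_meas [measurable]: "(\<lambda>p. count_below n (\<lambda>i. X i (fst p)) (snd p))
      \<in> borel_measurable (M \<Otimes>\<^sub>M lborel)"
    if "\<And>i. i \<in> {1..n} \<Longrightarrow> X i \<in> borel_measurable M" for X
  proof (rule measurable_count_below)
    fix i assume "i \<in> {1..n}"
    then have [measurable]: "X i \<in> borel_measurable M"
      by (rule that)
    show "(\<lambda>p. X i (fst p)) \<in> borel_measurable (M \<Otimes>\<^sub>M lborel)"
      by measurable
  qed measurable
  have G_meas [measurable]: "(\<lambda>p. G (fst p) (snd p)) \<in> borel_measurable (M \<Otimes>\<^sub>M lborel)"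
    unfolding G_def using count_meas[OF Z] count_meas[OF \<eta>] by measurable
  have pointwise: "ennreal (inner_upto n (\<lambda>k. \<omega> (\<psi> k s))
            (\<lambda>k. \<phi> \<bar>increasing_rearrangement n (\<lambda>i. Z i s) k - \<psi> k s\<bar>))
      \<le> ennreal W * (\<integral>\<^sup>+ x. ennreal (h x * G s x) \<partial>lborel)"
    if s: "s \<in> space M" for s
  proof -
    let ?u = "increasing_rearrangement n (\<lambda>i. Z i s)" and ?v = "\<lambda>k. \<psi> k s"
    have "inner_upto n (\<lambda>k. \<omega> (?v k)) (\<lambda>k. \<phi> \<bar>?u k - ?v k\<bar>) \<le> W * (\<Sum>k=1..n. \<phi> \<bar>?u k - ?v k\<bar>)"
      unfolding inner_upto_def sum_distrib_left
      using \<omega> nonneg by (intro sum_mono mult_right_mono) auto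
    then have "ennreal (inner_upto n (\<lambda>k. \<omega> (?v k)) (\<lambda>k. \<phi> \<bar>?u k - ?v k\<bar>))
      \<le> ennreal W * (\<Sum>k=1..n. ennreal (\<phi> \<bar>?u k - ?v k\<bar>))"
      using W nonneg by (simp add: ennreal_leI sum_nonneg flip: ennreal_mult)
    also have "\<dots> \<le> ennreal W * (\<Sum>k=1..n.
        \<integral>\<^sup>+ x. ennreal (h x * \<bar>indicator {..x} (?u k) - indicator {..x} (?v k)\<bar>) \<partial>lborel)"
      by (intro mult_left_mono sum_mono \<phi>) auto
    also have "\<dots> = ennreal W * (\<integral>\<^sup>+ x. (\<Sum>k=1..n.
        ennreal (h x * \<bar>indicator {..x} (?u k) - indicator {..x} (?v k)\<bar>)) \<partial>lborel)"
    proof (subst nn_integral_sum)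
      have [measurable]: "(\<lambda>x. indicator {..x} a :: real) \<in> borel_measurable borel" for a :: real
      proof -
        have "(\<lambda>x. indicator {..x} a :: real) = indicator {a..}"
          by (auto simp: indicator_def)
        then show ?thesis
          by simp
      qed
      show "(\<lambda>x. ennreal (h x * \<bar>indicator {..x} (?u k) - indicator {..x} (?v k)\<bar>))
          \<in> borel_measurable lborel" for k
        by measurable
    qed simp
    also have "(\<lambda>x. \<Sum>k=1..n. ennreal (h x * \<bar>indicator {..x} (?u k) - indicator {..x} (?v k)\<bar>))
      = (\<lambda>x. ennreal (h x * G s x))"
    proof
      fix x
      \<comment> \<open>Both vectors are sorted, so the sum collapses to one difference of counts;
        these are the counts of the unsorted \<open>Z\<close> and of \<open>\<eta>\<close>.\<close>
      have "(\<Sum>k=1..n. \<bar>indicator {..x} (?u k) - indicator {..x} (?v k)\<bar>) = G s x"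
        using \<psi>_mono[OF s]
        by (subst sum_abs_indicator_diff_mono)
          (auto simp: G_def \<psi>_count[OF s] count_below_increasing_rearrangement
            intro: increasing_rearrangement_mono)
      then show "(\<Sum>k=1..n. ennreal (h x * \<bar>indicator {..x} (?u k) - indicator {..x} (?v k)\<bar>))
        = ennreal (h x * G s x)"
        using h(2) by (simp flip: sum_distrib_left)
    qed
    finally show ?thesis .
  qed
  \<comment> \<open>Triangle inequality through the common centre \<open>c x\<close>; no joint law
    of \<open>Z\<close> and \<open>\<eta>\<close> enters.\<close>
  have level: "(\<integral>\<^sup>+ s. ennreal (G s x) \<partial>M) \<le> ennreal ((A + B) * r x)" for x
  proof -
    have [measurable]: "(\<lambda>s. count_below n (\<lambda>i. Z i s) x) \<in> borel_measurable M"
      "(\<lambda>s. count_below n (\<lambda>i. \<eta> i s) x) \<in> borel_measurable M"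
      using Z \<eta> by (auto intro: measurable_count_below)
    have "(\<integral>\<^sup>+ s. ennreal (G s x) \<partial>M) \<le> (\<integral>\<^sup>+ s. ennreal \<bar>count_below n (\<lambda>i. Z i s) x - c x\<bar>
        + ennreal \<bar>count_below n (\<lambda>i. \<eta> i s) x - c x\<bar> \<partial>M)"
      by (intro nn_integral_mono) (auto simp: G_def intro!: ennreal_leI simp flip: ennreal_plus)
    also have "\<dots> = (\<integral>\<^sup>+ s. ennreal \<bar>count_below n (\<lambda>i. Z i s) x - c x\<bar> \<partial>M)
        + (\<integral>\<^sup>+ s. ennreal \<bar>count_below n (\<lambda>i. \<eta> i s) x - c x\<bar> \<partial>M)"
      by (intro nn_integral_add) measurable
    also have "\<dots> \<le> ennreal (A * r x) + ennreal (B * r x)"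
      by (intro add_mono Z_dev \<eta>_dev)
    also have "\<dots> = ennreal ((A + B) * r x)"
      using nonneg by (simp add: distrib_right flip: ennreal_plus)
    finally show ?thesis .
  qed
  have "(\<integral>\<^sup>+ s. ennreal (inner_upto n (\<lambda>k. \<omega> (\<psi> k s))
            (\<lambda>k. \<phi> \<bar>increasing_rearrangement n (\<lambda>i. Z i s) k - \<psi> k s\<bar>)) \<partial>M)
    \<le> (\<integral>\<^sup>+ s. ennreal W * (\<integral>\<^sup>+ x. ennreal (h x * G s x) \<partial>lborel) \<partial>M)"
    by (rule nn_integral_mono) (rule pointwise)
  also have "\<dots> = ennreal W * (\<integral>\<^sup>+ s. (\<integral>\<^sup>+ x. ennreal (h x * G s x) \<partial>lborel) \<partial>M)"
    by (rule nn_integral_cmult) measurable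
  also have "(\<integral>\<^sup>+ s. (\<integral>\<^sup>+ x. ennreal (h x * G s x) \<partial>lborel) \<partial>M)
    = (\<integral>\<^sup>+ x. (\<integral>\<^sup>+ s. ennreal (h x * G s x) \<partial>M) \<partial>lborel)"
    by (rule Fubini'[symmetric]) measurable
  also have "\<dots> \<le> (\<integral>\<^sup>+ x. ennreal (A + B) * ennreal (h x * r x) \<partial>lborel)"
  proof (rule nn_integral_mono)
    fix x
    have [measurable]: "(\<lambda>s. G s x) \<in> borel_measurable M"
      unfolding G_def using Z \<eta> by (auto intro: measurable_count_below)
    have "(\<integral>\<^sup>+ s. ennreal (h x * G s x) \<partial>M) = ennreal (h x) * (\<integral>\<^sup>+ s. ennreal (G s x) \<partial>M)"
      using h(2) by (simp add: ennreal_mult' nn_integral_cmult)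
    also have "\<dots> \<le> ennreal (h x) * ennreal ((A + B) * r x)"
      by (intro mult_left_mono level) simp
    also have "\<dots> = ennreal (A + B) * ennreal (h x * r x)"
      using h(2) nonneg by (simp add: mult_ac del: ennreal_plus flip: ennreal_mult)
    finally show "(\<integral>\<^sup>+ s. ennreal (h x * G s x) \<partial>M) \<le> ennreal (A + B) * ennreal (h x * r x)" .
  qed
  also have "\<dots> = ennreal (A + B) * (\<integral>\<^sup>+ x. ennreal (h x * r x) \<partial>lborel)"
    by (rule nn_integral_cmult) measurable
  also have "ennreal W * \<dots> = ennreal (W * (A + B)) * (\<integral>\<^sup>+ x. ennreal (h x * r x) \<partial>lborel)"
    using W nonneg by (simp add: ennreal_mult mult.assoc)
  finally show ?thesis
    by (simp add: mult_left_mono)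
qed

section \<open>The two moment bounds\<close>

theorem proposition4p9:
  fixes M :: "'a measure" and n :: nat
    and Z \<psi> :: "nat \<Rightarrow> 'a \<Rightarrow> real"
    and \<Psi> \<omega> :: "real \<Rightarrow> real"
    and \<rho> :: "nat \<Rightarrow> nat \<Rightarrow> real" and W D :: real
  assumes "prob_space M" and "n \<ge> 1"
    and "stationary_vector M n Z"
    and "has_marginal_cdf M n Z \<Psi>"
    and "deterministic_proxy M n \<Psi> \<psi> \<or> random_proxy M n \<Psi> \<psi>"
    and "continuous_on UNIV \<omega>" and "bounded (range \<omega>)" and "\<And>x. \<omega> x \<ge> 0"
    and "W = (SUP x. \<bar>\<omega> x\<bar>)"
    and "\<And>i j. i \<in> {1..n} \<Longrightarrow> j \<in> {1..n} \<Longrightarrow> \<rho> i j \<ge> 0"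
    and "\<And>i j x. i \<in> {1..n} \<Longrightarrow> j \<in> {1..n} \<Longrightarrow>
           \<bar>covariance M (\<lambda>s. indicator {..x} (Z i s)) (\<lambda>s. indicator {..x} (Z j s))\<bar>
             \<le> \<rho> i j * (\<Psi> x * (1 - \<Psi> x))"
    and "D = (\<Sum>i=1..n. \<Sum>j=1..n. \<rho> i j)"
  shows "(\<integral>\<^sup>+ s. ennreal (inner_upto n (\<lambda>k. \<omega> (\<psi> k s))
              (\<lambda>k. \<bar>increasing_rearrangement n (\<lambda>i. Z i s) k - \<psi> k s\<bar>)) \<partial>M)
           \<le> ennreal (W * (sqrt D + sqrt (real n))) *
             (\<integral>\<^sup>+ x. ennreal (sqrt (\<Psi> x * (1 - \<Psi> x))) \<partial>lborel)
       \<and> (\<integral>\<^sup>+ s. ennreal (inner_upto n (\<lambda>k. \<omega> (\<psi> k s))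
              (\<lambda>k. \<bar>increasing_rearrangement n (\<lambda>i. Z i s) k - \<psi> k s\<bar>\<^sup>2)) \<partial>M)
           \<le> ennreal (4 * W * (sqrt D + sqrt (real n))) *
             (\<integral>\<^sup>+ x. ennreal (\<bar>x\<bar> * sqrt (\<Psi> x * (1 - \<Psi> x))) \<partial>lborel)"
proof -
  interpret prob_space M by fact
  have Z: "Z i \<in> borel_measurable M" if "i \<in> {1..n}" for i
    using assms(3) that by (simp add: stationary_vector_def)
  \<comment> \<open>Since \<open>n \<ge> 1\<close>, the law of \<open>Z 1\<close> shows that
    \<open>\<Psi>\<close> is a genuine distribution function, with its monotonicity, limits and
    right continuity.\<close>
  define N where "N = distr M borel (Z 1)"
  have "Z 1 \<in> borel_measurable M"
    using Z assms(2) by simp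
  then interpret N: real_distribution N
    unfolding N_def by (rule real_distribution_distr)
  have \<Psi>: "\<Psi> = cdf N"
    using assms(2,4) by (auto simp: has_marginal_cdf_def N_def)
  have "mono (cdf N)"
    using N.cdf_nondecreasing by (auto intro: monoI)
  then have [measurable]: "\<Psi> \<in> borel_measurable borel"
    unfolding \<Psi> by (rule borel_measurable_mono)
  define r where "r x = sqrt (\<Psi> x * (1 - \<Psi> x))" for x
  have r: "r \<in> borel_measurable borel" "\<And>x. 0 \<le> r x"
    unfolding r_def[abs_def] using N.cdf_nonneg N.cdf_bounded_prob
    by (auto simp: \<Psi>[symmetric])
  have D: "0 \<le> D"
    unfolding assms(12) by (intro sum_nonneg assms(10)) auto
  have bdd: "bdd_above (range (\<lambda>x. \<bar>\<omega> x\<bar>))"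
    using assms(7) by (auto simp: bounded_iff intro: bdd_aboveI)
  have \<omega>: "\<omega> x \<le> W" for x
    using cSUP_upper[OF UNIV_I bdd, of x] assms(8)[of x] by (simp add: assms(9))
  have Z_dev: "(\<integral>\<^sup>+ s. ennreal \<bar>count_below n (\<lambda>i. Z i s) x - real n * \<Psi> x\<bar> \<partial>M)
      \<le> ennreal (sqrt D * r x)" for x
    unfolding assms(12) r_def
    by (rule nn_integral_count_below_deviation_le)
      (use Z assms(4) in \<open>auto intro: order_trans[OF abs_ge_self assms(11)]\<close>)
  \<comment> \<open>The two proxies are unified here: \<open>\<eta>\<close> is the constant vector
    of quantiles in the deterministic case and the unsorted sample in the random case.\<close>
  obtain \<eta> where \<eta>: "\<And>i. i \<in> {1..n} \<Longrightarrow> \<eta> i \<in> borel_measurable M"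
    and \<psi>_mono: "\<And>s j k. s \<in> space M \<Longrightarrow> 1 \<le> j \<Longrightarrow> j \<le> k \<Longrightarrow> k \<le> n \<Longrightarrow> \<psi> j s \<le> \<psi> k s"
    and \<psi>_count: "\<And>s x. s \<in> space M \<Longrightarrow>
      count_below n (\<lambda>k. \<psi> k s) x = count_below n (\<lambda>i. \<eta> i s) x"
    and \<eta>_dev: "\<And>x. (\<integral>\<^sup>+ s. ennreal \<bar>count_below n (\<lambda>i. \<eta> i s) x - real n * \<Psi> x\<bar> \<partial>M)
      \<le> ennreal (sqrt (real n) * r x)"
    using assms(5)
  proof (elim disjE, goal_cases)
    case 1
    let ?q = "\<lambda>k. quantile \<Psi> (real k / (real n + 1))"
    have \<psi>: "\<psi> k s = ?q k" if "s \<in> space M" "1 \<le> k" "k \<le> n" for s k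
      using 1(2) that by (simp add: deterministic_proxy_def)
    show ?case
    proof (rule 1(1)[of "\<lambda>k s. ?q k"])
      show "\<psi> j s \<le> \<psi> k s" if "s \<in> space M" "1 \<le> j" "j \<le> k" "k \<le> n" for s j k
      proof -
        have "?q j \<le> ?q k"
          unfolding \<Psi> using that by (intro N.quantile_mono) (auto simp: divide_right_mono)
        then show ?thesis
          using that by (simp add: \<psi>)
      qed
      show "count_below n (\<lambda>k. \<psi> k s) x = count_below n ?q x" if "s \<in> space M" for s x
        unfolding count_below_def using that by (intro sum.cong) (auto simp: \<psi>)
      show "(\<integral>\<^sup>+ s. ennreal \<bar>count_below n ?q x - real n * \<Psi> x\<bar> \<partial>M) \<le> ennreal (sqrt (real n) * r x)"
        for x
        using N.count_below_quantile_deviation_le[of n x]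
        by (simp add: emeasure_space_1 \<Psi> r_def ennreal_leI)
    qed auto
  next
    case 2
    then obtain \<xi> where \<xi>: "iid_sample M n \<xi> \<Psi>"
      and \<psi>: "\<And>s k. s \<in> space M \<Longrightarrow> 1 \<le> k \<Longrightarrow> k \<le> n \<Longrightarrow>
        \<psi> k s = increasing_rearrangement n (\<lambda>i. \<xi> i s) k"
      by (auto simp: random_proxy_def)
    show ?case
    proof (rule 2(1)[of \<xi>])
      show "\<xi> i \<in> borel_measurable M" if "i \<in> {1..n}" for i
        using \<xi> that by (auto simp: iid_sample_def indep_vars_def)
      show "\<psi> j s \<le> \<psi> k s" if "s \<in> space M" "1 \<le> j" "j \<le> k" "k \<le> n" for s j k
        using that by (simp add: \<psi> increasing_rearrangement_mono)
      show "count_below n (\<lambda>k. \<psi> k s) x = count_below n (\<lambda>i. \<xi> i s) x" if "s \<in> space M" for s x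
      proof -
        have "count_below n (\<lambda>k. \<psi> k s) x
          = count_below n (increasing_rearrangement n (\<lambda>i. \<xi> i s)) x"
          unfolding count_below_def using that by (intro sum.cong) (auto simp: \<psi>)
        then show ?thesis
          by (simp add: count_below_increasing_rearrangement)
      qed
      show "(\<integral>\<^sup>+ s. ennreal \<bar>count_below n (\<lambda>i. \<xi> i s) x - real n * \<Psi> x\<bar> \<partial>M)
        \<le> ennreal (sqrt (real n) * r x)" for x
        unfolding r_def by (rule nn_integral_count_below_iid_deviation_le[OF \<xi>])
    qed
  qed
  have bound: "(\<integral>\<^sup>+ s. ennreal (inner_upto n (\<lambda>k. \<omega> (\<psi> k s))
        (\<lambda>k. \<phi> \<bar>increasing_rearrangement n (\<lambda>i. Z i s) k - \<psi> k s\<bar>)) \<partial>M)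
      \<le> ennreal (W * (sqrt D + sqrt (real n))) * (\<integral>\<^sup>+ x. ennreal (h x * r x) \<partial>lborel)"
    if "h \<in> borel_measurable borel" "\<And>x. 0 \<le> h x" "\<And>y. 0 \<le> \<phi> y"
      "\<And>a b. ennreal (\<phi> \<bar>a - b\<bar>)
        \<le> (\<integral>\<^sup>+ x. ennreal (h x * \<bar>indicator {..x} a - indicator {..x} b\<bar>) \<partial>lborel)"
    for h \<phi> :: "real \<Rightarrow> real"
  proof (rule nn_integral_inner_upto_rearrangement_le[where \<eta> = \<eta> and r = r and A = "sqrt D"
        and B = "sqrt (real n)" and c = "\<lambda>x. real n * \<Psi> x"])
    show "0 \<le> sqrt D" "0 \<le> sqrt (real n)"
      using D by auto
  qed (fact Z \<eta> \<psi>_mono \<psi>_count Z_dev \<eta>_dev assms(8) \<omega> r that)+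
  have "(\<integral>\<^sup>+ s. ennreal (inner_upto n (\<lambda>k. \<omega> (\<psi> k s))
        (\<lambda>k. \<bar>increasing_rearrangement n (\<lambda>i. Z i s) k - \<psi> k s\<bar>)) \<partial>M)
    \<le> ennreal (W * (sqrt D + sqrt (real n))) * (\<integral>\<^sup>+ x. ennreal (1 * r x) \<partial>lborel)"
  \<comment> \<open>The absolute value serves as \<open>\<phi>\<close>, rather than the identity,
    because \<open>\<phi>\<close> has to be nonnegative on all reals; idempotence removes the
    doubled bars.\<close>
  proof (rule bound[of "\<lambda>_. 1" "\<lambda>y. \<bar>y\<bar>", unfolded abs_idempotent])
    show "ennreal \<bar>a - b\<bar>
      \<le> (\<integral>\<^sup>+ x. ennreal (1 * \<bar>indicator {..x} a - indicator {..x} b\<bar>) \<partial>lborel)" for a b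
      unfolding mult_1 by (rule eq_refl) (rule abs_diff_eq_nn_integral_indicator)
  qed auto
  moreover have "(\<integral>\<^sup>+ s. ennreal (inner_upto n (\<lambda>k. \<omega> (\<psi> k s))
        (\<lambda>k. \<bar>increasing_rearrangement n (\<lambda>i. Z i s) k - \<psi> k s\<bar>\<^sup>2)) \<partial>M)
    \<le> ennreal (4 * W * (sqrt D + sqrt (real n))) * (\<integral>\<^sup>+ x. ennreal (\<bar>x\<bar> * r x) \<partial>lborel)"
  proof -
    have "0 \<le> W"
      using \<omega>[of 0] assms(8)[of 0] by linarith
    have "(\<integral>\<^sup>+ s. ennreal (inner_upto n (\<lambda>k. \<omega> (\<psi> k s))
        (\<lambda>k. \<bar>increasing_rearrangement n (\<lambda>i. Z i s) k - \<psi> k s\<bar>\<^sup>2)) \<partial>M)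
      \<le> ennreal (W * (sqrt D + sqrt (real n))) * (\<integral>\<^sup>+ x. ennreal (4 * \<bar>x\<bar> * r x) \<partial>lborel)"
      \<comment> \<open>The density \<open>4 * \<bar>x\<bar>\<close> of the squared distance is the
        source of the factor 4, which is then moved in front of the integral.\<close>
      by (rule bound[of "\<lambda>x. 4 * \<bar>x\<bar>" "\<lambda>y. y\<^sup>2"])
        (rule power2_diff_le_nn_integral_indicator | simp)+
    also have "(\<integral>\<^sup>+ x. ennreal (4 * \<bar>x\<bar> * r x) \<partial>lborel)
      = (\<integral>\<^sup>+ x. ennreal 4 * ennreal (\<bar>x\<bar> * r x) \<partial>lborel)"
      using r(2) by (intro nn_integral_cong) (simp add: mult.assoc ennreal_mult)
    also have "\<dots> = ennreal 4 * (\<integral>\<^sup>+ x. ennreal (\<bar>x\<bar> * r x) \<partial>lborel)"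
      using r(1) by (intro nn_integral_cmult) measurable
    also have "ennreal (W * (sqrt D + sqrt (real n))) * \<dots>
      = ennreal (4 * W * (sqrt D + sqrt (real n))) * (\<integral>\<^sup>+ x. ennreal (\<bar>x\<bar> * r x) \<partial>lborel)"
      using \<open>0 \<le> W\<close> D by (simp add: ennreal_mult algebra_simps)
    finally show ?thesis .
  qed
  ultimately show ?thesis
    by (simp only: r_def mult_1)
qed

end
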